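(* Let $n\ge 2$ and let the domain of locations be $X=[0,1]$. A randomized facility location mechanism for $n$ agents on $X$ is universally anonymous, universally truthful and satisfies Strong Proportionality in expectation if and only if it is the Random Rank mechanism.
   Context: Let $N=\{1,\dots,n\}$ be a set of agents, $n\ge 2$, and $X=[0,1]$. A location profile is $x=(x_1,\dots,x_n)\in X^n$, and $d(a,b)=|a-b|$. A deterministic mechanism is a map $f:X^n\to X$. It is anonymous if $f(x_{\sigma(1)},\dots,x_{\sigma(n)})=f(x)$ for every $x\in X^n$ and every bijection $\sigma:N\to N$. It is strategyproof if for every agent $i\in N$, all $x_i,x_i'\in X$ and every profile $\hat x_{-i}$ of locations of the other agents, $d(x_i,f(x_i,\hat x_{-i}))\le d(x_i,f(x_i',\hat x_{-i}))$. A randomized mechanism is a probability distribution over deterministic mechanisms, i.e. a random deterministic mechanism $f$ (such that $f(x)$ is a random variable for each fixed $x\in X^n$). It is universally anonymous (respectively universally truthful) if it is a distribution over deterministic anonymous (respectively deterministic strategyproof) mechanisms, i.e. the realized mechanism is almost surely anonymous (respectively strategyproof). "It is the Random Rank mechanism" means equality as probability distributions over deterministic mechanisms. A randomized mechanism $f$ satisfies Strong Proportionality in expectation if for all $0\le\alpha<\beta\le 1$, every profile $x\in\{\alpha,\beta\}^n$ and every set $S\subseteq N$ of agents at the same location, $\mathbb{E}[d(x_i,f(x))]\le \frac{n-|S|}{n}(\beta-\alpha)$ for all $i\in S$. For $k\in\{1,\dots,n\}$ let $\operatorname{rank}^k(x)=\operatorname{med}(\underbrace{0,\dots,0}_{n-k},\underbrace{1,\dots,1}_{k-1},x_1,\dots,x_n)$,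 the median of these $2n-1$ numbers. The Random Rank mechanism chooses $k$ uniformly at random from $\{1,\dots,n\}$ and uses the deterministic mechanism $\operatorname{rank}^k$. *)

theory Defs
  imports "HOL-Probability.Probability"
begin

text \<open>
  Agents are the numbers \<open>1, \<dots>, n\<close>. Profiles and mechanisms are extensional functions
  (undefined outside their domain), so that HOL equality of mechanisms is equality of maps
  \<open>X^n \<rightarrow> X\<close>.
\<close>

type_synonym profile = "nat \<Rightarrow> real"
type_synonym mechanism = "profile \<Rightarrow> real"

definition profiles :: "nat \<Rightarrow> profile set" where
  "profiles n = {1..n} \<rightarrow>\<^sub>E {0..1}"

definition mechanisms :: "nat \<Rightarrow> mechanism set" where
  "mechanisms n = profiles n \<rightarrow>\<^sub>E {0..1}"

definition anonymous :: "nat \<Rightarrow> mechanism \<Rightarrow> bool" where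
  "anonymous n f \<longleftrightarrow>
     (\<forall>x\<in>profiles n. \<forall>\<sigma>. bij_betw \<sigma> {1..n} {1..n} \<longrightarrow> f (\<lambda>i\<in>{1..n}. x (\<sigma> i)) = f x)"

definition strategyproof :: "nat \<Rightarrow> mechanism \<Rightarrow> bool" where
  "strategyproof n f \<longleftrightarrow>
     (\<forall>x\<in>profiles n. \<forall>i\<in>{1..n}. \<forall>y\<in>{0..1}. dist (x i) (f x) \<le> dist (x i) (f (x(i := y))))"

text \<open>
  The \<open>\<sigma>\<close>-algebra on the set of mechanisms is part of \<open>M\<close>: any one making all evaluations
  \<open>f \<mapsto> f x\<close> measurable is allowed. It must not be fixed to be the one generated by the
  evaluations: a nonempty event of that \<open>\<sigma>\<close>-algebra constrains only countably many profiles
  and hence always contains mechanisms that are not strategyproof, so no distribution on it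
  would be almost surely strategyproof.
\<close>

definition randomized_mechanism :: "nat \<Rightarrow> mechanism measure \<Rightarrow> bool" where
  "randomized_mechanism n M \<longleftrightarrow>
     prob_space M \<and> space M = mechanisms n \<and>
     (\<forall>x\<in>profiles n. (\<lambda>f. f x) \<in> borel_measurable M)"

definition universally_anonymous :: "nat \<Rightarrow> mechanism measure \<Rightarrow> bool" where
  "universally_anonymous n M \<longleftrightarrow> (AE f in M. anonymous n f)"

definition universally_truthful :: "nat \<Rightarrow> mechanism measure \<Rightarrow> bool" where
  "universally_truthful n M \<longleftrightarrow> (AE f in M. strategyproof n f)"

definition strongly_proportional_in_expectation :: "nat \<Rightarrow> mechanism measure \<Rightarrow> bool" where
  "strongly_proportional_in_expectation n M \<longleftrightarrow>
     (\<forall>\<alpha> \<beta>. 0 \<le> \<alpha> \<and> \<alpha> < \<beta> \<and> \<beta> \<le> 1 \<longrightarrow>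
       (\<forall>x \<in> {1..n} \<rightarrow>\<^sub>E {\<alpha>, \<beta>}. \<forall>S \<subseteq> {1..n}. (\<forall>i\<in>S. \<forall>j\<in>S. x i = x j) \<longrightarrow>
         (\<forall>i\<in>S. (\<integral>f. dist (x i) (f x) \<partial>M) \<le> (real n - real (card S)) / real n * (\<beta> - \<alpha>))))"

text \<open>Only used for lists of odd length.\<close>

definition median :: "real list \<Rightarrow> real" where
  "median xs = sort xs ! (length xs div 2)"

definition rank_mechanism :: "nat \<Rightarrow> nat \<Rightarrow> mechanism" where
  "rank_mechanism n k = (\<lambda>x\<in>profiles n.
     median (replicate (n - k) 0 @ replicate (k - 1) 1 @ map x [1..<Suc n]))"

text \<open>
  The Random Rank distribution is discrete, so it is defined on all sets of mechanisms. A
  randomized mechanism \<open>M\<close> carrying a smaller \<open>\<sigma>\<close>-algebra is to be compared with it through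
  \<open>completion M\<close>, which only adds subsets of null events.
\<close>

definition random_rank :: "nat \<Rightarrow> mechanism measure" where
  "random_rank n = distr (uniform_count_measure {1..n}) (count_space (mechanisms n)) (rank_mechanism n)"

end

theory Submission
  imports Defs
begin

text \<open>
  Strong Proportionality makes almost every realization \<open>f\<close> unanimous. For a unanimous
  strategyproof \<open>f\<close> let \<open>p S\<close> be the outcome when exactly the agents in \<open>S\<close> are at \<open>1\<close> and
  the others at \<open>0\<close>. Moving agents towards the outcome never changes it, and this gives
  \<open>p {i. x\<^sub>i > f x} \<le> f x \<le> p {i. x\<^sub>i \<ge> f x}\<close>. So \<open>p\<close> determines \<open>f\<close>, and if \<open>f\<close> is anonymous and
  all \<open>p S\<close> are \<open>0\<close> or \<open>1\<close>, then \<open>f\<close> is a rank mechanism. Strong Proportionality fixes the mean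
  of \<open>p S\<close> as \<open>card S / n\<close>; the same condition with \<open>1/2\<close> in place of \<open>1\<close> forces
  \<open>p S \<in> {0, 1}\<close> almost surely, and the means then give every rank the probability \<open>1 / n\<close>.
\<close>

section \<open>Rank mechanisms\<close>

lemma sorted_nth_le_iff:
  fixes xs :: "'a :: linorder list"
  assumes "sorted xs" "m < length xs"
  shows "xs ! m \<le> y \<longleftrightarrow> m < length (filter (\<lambda>a. a \<le> y) xs)"
  using assms
proof (induction xs arbitrary: m)
  case Nil
  then show ?case by simp
next
  case (Cons a xs)
  show ?case
  proof (cases "a \<le> y")
    case True
    then show ?thesis using Cons by (cases m) auto
  next
    case False
    then have none: "\<forall>b\<in>set (a # xs). \<not> b \<le> y"
      using Cons.prems by (auto intro: order_trans)
    then have "filter (\<lambda>a. a \<le> y) (a # xs) = []"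
      by (simp add: filter_empty_conv)
    moreover have "\<not> (a # xs) ! m \<le> y"
      using none nth_mem[OF Cons.prems(2)] by blast
    ultimately show ?thesis by simp
  qed
qed

lemma median_le_iff:
  assumes "xs \<noteq> []"
  shows "median xs \<le> y \<longleftrightarrow> length xs div 2 < length (filter (\<lambda>a. a \<le> y) xs)"
proof -
  have "length (filter (\<lambda>a. a \<le> y) (sort xs)) = length (filter (\<lambda>a. a \<le> y) xs)"
    by (metis mset_filter mset_sort size_mset)
  with assms show ?thesis
    unfolding median_def by (subst sorted_nth_le_iff) auto
qed

text \<open>The median sits at index n - 1. For y < 1 the n - k zeros count as entries at most y and
  the ones do not, so the agents must supply k more. For y = 1 both sides hold. This turns
  \<open>rank_mechanism n k\<close> into the k-th smallest location.\<close>

lemma rank_mechanism_le_iff: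
  assumes x: "x \<in> profiles n" and k: "k \<in> {1..n}" and y: "0 \<le> y" "y \<le> 1"
  shows "rank_mechanism n k x \<le> y \<longleftrightarrow> k \<le> card {i\<in>{1..n}. x i \<le> y}"
proof -
  have x01: "x i \<in> {0..1}" if "i \<in> {1..n}" for i
    using x that by (auto simp: profiles_def)
  have "length (filter (\<lambda>a. a \<le> y) (map x [1..<Suc n])) = card {i\<in>{1..n}. x i \<le> y}"
  proof -
    have "length (filter (\<lambda>a. a \<le> y) (map x [1..<Suc n])) =
        length (filter (\<lambda>i. x i \<le> y) [1..<Suc n])"
      by (simp add: filter_map o_def del: upt_Suc)
    also have "\<dots> = card (set (filter (\<lambda>i. x i \<le> y) [1..<Suc n]))"
      by (rule distinct_card[symmetric]) simp
    also have "set (filter (\<lambda>i. x i \<le> y) [1..<Suc n]) = {i\<in>{1..n}. x i \<le> y}"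
      by auto
    finally show ?thesis .
  qed
  moreover have "card {i\<in>{1..n}. x i \<le> y} = n" if "y = 1"
  proof -
    have "{i\<in>{1..n}. x i \<le> y} = {1..n}" using x01 that by auto
    then show ?thesis by simp
  qed
  ultimately show ?thesis
    using x k y unfolding rank_mechanism_def
    by (cases "y = 1") (auto simp: median_le_iff simp del: upt_Suc)
qed

lemma rank_mechanism_in: "x \<in> profiles n \<Longrightarrow> k \<in> {1..n} \<Longrightarrow> rank_mechanism n k x \<in> {0..1}"
proof -
  assume x: "x \<in> profiles n" and k: "k \<in> {1..n}"
  have x01: "x i \<in> {0..1}" if "i \<in> {1..n}" for i
    using x that by (auto simp: profiles_def)
  let ?L = "replicate (n - k) 0 @ replicate (k - 1) 1 @ map x [1..<Suc n]"
  have "set ?L \<subseteq> {0..1}"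
    using x01 by (auto simp del: upt_Suc)
  moreover have "median ?L \<in> set ?L"
  proof -
    have "sort ?L ! (length ?L div 2) \<in> set (sort ?L)"
      using k by (intro nth_mem) auto
    then show ?thesis unfolding median_def by (simp only: set_sort)
  qed
  ultimately show ?thesis using x unfolding rank_mechanism_def by auto
qed

lemma rank_mechanism_mechanisms: "k \<in> {1..n} \<Longrightarrow> rank_mechanism n k \<in> mechanisms n"
proof -
  assume k: "k \<in> {1..n}"
  have "rank_mechanism n k \<in> extensional (profiles n)"
    by (simp add: rank_mechanism_def)
  then show ?thesis
    unfolding mechanisms_def using rank_mechanism_in[OF _ k] by (simp only: PiE_iff) blast
qed

text \<open>A point of [0,1] is determined by the y in [0,1] that lie above it: testing at c and at
  the rank outcome gives the two inequalities.\<close>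

lemma rank_mechanism_eqI:
  assumes "x \<in> profiles n" "k \<in> {1..n}" "0 \<le> c" "c \<le> 1"
    and "\<And>y. 0 \<le> y \<Longrightarrow> y \<le> 1 \<Longrightarrow> c \<le> y \<longleftrightarrow> k \<le> card {i\<in>{1..n}. x i \<le> y}"
  shows "rank_mechanism n k x = c"
proof (rule antisym)
  have r: "0 \<le> rank_mechanism n k x" "rank_mechanism n k x \<le> 1"
    using rank_mechanism_in[OF assms(1,2)] by auto
  show "rank_mechanism n k x \<le> c"
    using rank_mechanism_le_iff[OF assms(1-4)] assms(5)[OF assms(3,4)] by blast
  show "c \<le> rank_mechanism n k x"
    using rank_mechanism_le_iff[OF assms(1,2) r] assms(5)[OF r] by blast
qed

lemma permuted_profile:
  assumes "x \<in> profiles n" "bij_betw \<sigma> {1..n} {1..n}"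
  shows "(\<lambda>i\<in>{1..n}. x (\<sigma> i)) \<in> profiles n"
proof -
  have "x (\<sigma> i) \<in> {0..1}" if "i \<in> {1..n}" for i
    using assms(1) bij_betw_apply[OF assms(2) that] unfolding profiles_def by (rule PiE_mem)
  then show ?thesis unfolding profiles_def by (intro restrict_PiE_iff[THEN iffD2] ballI)
qed

lemma updated_profile:
  assumes "x \<in> profiles n" "i \<in> {1..n}" "y \<in> {0..1}"
  shows "x(i := y) \<in> profiles n"
  using assms by (auto simp: profiles_def PiE_iff extensional_def)

lemma anonymous_rank_mechanism:
  assumes k: "k \<in> {1..n}"
  shows "anonymous n (rank_mechanism n k)"
  unfolding anonymous_def
proof (intro ballI allI impI)
  fix x and \<sigma> :: "nat \<Rightarrow> nat"
  assume x: "x \<in> profiles n" and \<sigma>: "bij_betw \<sigma> {1..n} {1..n}"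
  have "card {i\<in>{1..n}. x (\<sigma> i) \<le> y} = card {i\<in>{1..n}. x i \<le> y}" for y
  proof (rule bij_betw_same_card)
    have "\<sigma> ` {i\<in>{1..n}. x (\<sigma> i) \<le> y} = {i\<in>\<sigma> ` {1..n}. x i \<le> y}" by auto
    also have "\<dots> = {i\<in>{1..n}. x i \<le> y}" by (simp only: bij_betw_imp_surj_on[OF \<sigma>])
    finally show "bij_betw \<sigma> {i\<in>{1..n}. x (\<sigma> i) \<le> y} {i\<in>{1..n}. x i \<le> y}"
      by (intro bij_betw_subset[OF \<sigma>]) auto
  qed
  moreover have "{i\<in>{1..n}. (\<lambda>i\<in>{1..n}. x (\<sigma> i)) i \<le> y} = {i\<in>{1..n}. x (\<sigma> i) \<le> y}" for y
    by auto
  ultimately show "rank_mechanism n k (\<lambda>i\<in>{1..n}. x (\<sigma> i)) = rank_mechanism n k x"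
    using rank_mechanism_le_iff[OF x k] rank_mechanism_in[OF x k]
    by (intro rank_mechanism_eqI permuted_profile x \<sigma> k) auto
qed

lemma strategyproof_rank_mechanism:
  assumes k: "k \<in> {1..n}"
  shows "strategyproof n (rank_mechanism n k)"
  unfolding strategyproof_def
proof (intro ballI)
  fix x i and y :: real
  assume x: "x \<in> profiles n" and i: "i \<in> {1..n}" and y: "y \<in> {0..1}"
  define x' where "x' = x(i := y)"
  have x': "x' \<in> profiles n"
    unfolding x'_def by (rule updated_profile[OF x i y])
  let ?c = "rank_mechanism n k x" and ?c' = "rank_mechanism n k x'"
  have c: "?c \<in> {0..1}" and c': "?c' \<in> {0..1}"
    using rank_mechanism_in x x' k by auto
  have xi: "x i \<in> {0..1}" using x i by (auto simp: profiles_def)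
  consider "x i = ?c" | "x i < ?c" | "x i > ?c" by linarith
  then have "dist (x i) ?c \<le> dist (x i) ?c'"
  proof cases
    case 1
    then show ?thesis by simp
  next
    case 2
    have "?c \<le> ?c'"
    proof (rule ccontr)
      assume less: "\<not> ?c \<le> ?c'"
      \<comment> \<open>At this level agent i is already counted under the truthful report, so no
        misreport raises the count; yet z still lies below the old outcome and not below the new
        one.\<close>
      define z where "z = max (x i) ?c'"
      have z: "0 \<le> z" "z \<le> 1" "?c' \<le> z" "z < ?c" "x i \<le> z"
        using less 2 xi c' by (auto simp: z_def)
      have "k \<le> card {j\<in>{1..n}. x' j \<le> z}"
        using rank_mechanism_le_iff[OF x' k z(1,2)] z by simp
      also have "\<dots> \<le> card {j\<in>{1..n}. x j \<le> z}"
        using z(5) by (intro card_mono) (auto simp: x'_def)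
      finally show False
        using rank_mechanism_le_iff[OF x k z(1,2)] z by simp
    qed
    with 2 show ?thesis by (simp add: dist_real_def)
  next
    case 3
    \<comment> \<open>Agent i is not counted at the level of the outcome, so a misreport can only
      increase that count.\<close>
    have "k \<le> card {j\<in>{1..n}. x j \<le> ?c}"
      using rank_mechanism_le_iff[OF x k, of ?c] c by simp
    also have "\<dots> \<le> card {j\<in>{1..n}. x' j \<le> ?c}"
      using 3 by (intro card_mono) (auto simp: x'_def)
    finally have "?c' \<le> ?c"
      using rank_mechanism_le_iff[OF x' k, of ?c] c by simp
    with 3 show ?thesis by (simp add: dist_real_def)
  qed
  then show "dist (x i) ?c \<le> dist (x i) (rank_mechanism n k (x(i := y)))"
    unfolding x'_def .
qed

section \<open>Two-valued profiles\<close>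

definition two_valued :: "nat \<Rightarrow> nat set \<Rightarrow> real \<Rightarrow> real \<Rightarrow> profile" where
  "two_valued n S a b = (\<lambda>i\<in>{1..n}. if i \<in> S then b else a)"

lemma two_valued_apply [simp]: "i \<in> {1..n} \<Longrightarrow> two_valued n S a b i = (if i \<in> S then b else a)"
  by (simp add: two_valued_def)

lemma two_valued_profiles [intro]:
  "a \<in> {0..1} \<Longrightarrow> b \<in> {0..1} \<Longrightarrow> two_valued n S a b \<in> profiles n"
  by (auto simp: two_valued_def profiles_def)

lemma two_valued_PiE: "two_valued n S a b \<in> {1..n} \<rightarrow>\<^sub>E {a, b}"
  by (auto simp: two_valued_def)

lemma rank_mechanism_two_valued:
  assumes k: "k \<in> {1..n}" and S: "S \<subseteq> {1..n}" and ab: "0 \<le> a" "a < b" "b \<le> 1"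
  shows "rank_mechanism n k (two_valued n S a b) = (if n < k + card S then b else a)"
proof (rule rank_mechanism_eqI[OF _ k])
  show "two_valued n S a b \<in> profiles n" using ab by auto
  show "0 \<le> (if n < k + card S then b else a)" "(if n < k + card S then b else a) \<le> 1"
    using ab by auto
  fix y :: real assume "0 \<le> y" "y \<le> 1"
  have fin: "finite S" using S finite_subset by blast
  have cc: "card ({1..n} - S) = n - card S" "card S \<le> n"
    using S fin card_mono[OF _ S] by (auto simp: card_Diff_subset)
  consider "y < a" | "a \<le> y" "y < b" | "b \<le> y" by linarith
  then show "(if n < k + card S then b else a) \<le> y \<longleftrightarrow>
      k \<le> card {i\<in>{1..n}. two_valued n S a b i \<le> y}"
  proof cases
    case 1
    then have "{i\<in>{1..n}. two_valued n S a b i \<le> y} = {}" using ab by auto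
    then have "card {i\<in>{1..n}. two_valued n S a b i \<le> y} = 0" by (simp only: card.empty)
    with 1 k ab show ?thesis by (simp only:) auto
  next
    case 2
    then have "{i\<in>{1..n}. two_valued n S a b i \<le> y} = {1..n} - S" by auto
    then have "card {i\<in>{1..n}. two_valued n S a b i \<le> y} = n - card S" by (simp only: cc)
    with 2 k ab cc show ?thesis by (simp only:) auto
  next
    case 3
    then have "{i\<in>{1..n}. two_valued n S a b i \<le> y} = {1..n}" using ab by auto
    then have "card {i\<in>{1..n}. two_valued n S a b i \<le> y} = n" by (simp only: card_atLeastAtMost)
    with 3 k ab show ?thesis by auto
  qed
qed

lemma inj_on_rank_mechanism: "inj_on (rank_mechanism n) {1..n}"
proof -
  \<comment> \<open>The profile with exactly n - k agents at 1 separates the ranks: rank k selects 0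
    there, every higher rank selects 1.\<close>
  have False if "k \<in> {1..n}" "l \<in> {1..n}" "k < l" "rank_mechanism n k = rank_mechanism n l" for k l
    using rank_mechanism_two_valued[of k n "{1..n - k}" 0 1]
      rank_mechanism_two_valued[of l n "{1..n - k}" 0 1] that by (auto split: if_splits)
  then show ?thesis
    unfolding inj_on_def by (metis linorder_neqE_nat)
qed

lemma anonymous_two_valued:
  assumes f: "anonymous n f" and ab: "a \<in> {0..1}" "b \<in> {0..1}"
    and S: "S \<subseteq> {1..n}" "S' \<subseteq> {1..n}" "card S = card S'"
  shows "f (two_valued n S a b) = f (two_valued n S' a b)"
proof -
  have fin: "finite S" "finite S'" using S finite_subset by blast+
  have "card ({1..n} - S') = card ({1..n} - S)"
    using S fin by (simp add: card_Diff_subset)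
  then obtain h where h: "bij_betw h ({1..n} - S') ({1..n} - S)"
    using finite_same_card_bij[of "{1..n} - S'" "{1..n} - S"] by auto
  obtain g where g: "bij_betw g S' S"
    using finite_same_card_bij fin S by metis
  \<comment> \<open>Anonymity needs a permutation of all agents, so a bijection from
    \<open>S'\<close> to \<open>S\<close> is glued to one between the complements.\<close>
  define \<sigma> where "\<sigma> = (\<lambda>i. if i \<in> S' then g i else h i)"
  have "bij_betw \<sigma> S' S"
    using g by (rule bij_betw_cong[THEN iffD1, rotated]) (simp add: \<sigma>_def)
  moreover have "bij_betw \<sigma> ({1..n} - S') ({1..n} - S)"
    using h by (rule bij_betw_cong[THEN iffD1, rotated]) (simp add: \<sigma>_def)
  ultimately have "bij_betw \<sigma> (S' \<union> ({1..n} - S')) (S \<union> ({1..n} - S))"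
    by (rule bij_betw_combine) auto
  moreover have "S' \<union> ({1..n} - S') = {1..n}" "S \<union> ({1..n} - S) = {1..n}"
    using S by auto
  ultimately have \<sigma>: "bij_betw \<sigma> {1..n} {1..n}" by simp
  have "(\<lambda>i\<in>{1..n}. two_valued n S a b (\<sigma> i)) = two_valued n S' a b"
  proof
    fix i
    have "\<sigma> i \<in> {1..n}" "\<sigma> i \<in> S \<longleftrightarrow> i \<in> S'" if "i \<in> {1..n}"
      using that bij_betw_apply[OF \<sigma>] bij_betw_apply[OF g] bij_betw_apply[OF h]
      by (auto simp: \<sigma>_def)
    then show "(\<lambda>i\<in>{1..n}. two_valued n S a b (\<sigma> i)) i = two_valued n S' a b i"
      by (auto simp: two_valued_def)
  qed
  with f ab \<sigma> show ?thesis
    unfolding anonymous_def by (metis two_valued_profiles)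
qed

section \<open>Strategyproof mechanisms\<close>

text \<open>Agents move one at a time; the set \<open>T\<close> collects those that have moved, and
  the outcome stays the same along the way.\<close>

lemma strategyproof_invariant:
  assumes f: "strategyproof n f" and x: "x \<in> profiles n" and y: "y \<in> profiles n"
    and between: "\<And>i. i \<in> {1..n} \<Longrightarrow> f x \<le> y i \<and> y i \<le> x i \<or> x i \<le> y i \<and> y i \<le> f x"
  shows "f y = f x"
proof -
  have "f (\<lambda>i. if i \<in> T then y i else x i) = f x" if "finite T" "T \<subseteq> {1..n}" for T
    using that
  proof (induction T rule: finite_induct)
    case empty
    then show ?case by simp
  next
    case (insert i T)
    define w where "w = (\<lambda>i. if i \<in> T then y i else x i)"
    have w: "w \<in> profiles n"
      using x y by (auto simp: w_def profiles_def PiE_iff extensional_def)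
    have i: "i \<in> {1..n}" using insert by auto
    have yi: "y i \<in> {0..1}" and xi: "x i \<in> {0..1}"
      using x y i by (auto simp: profiles_def)
    have fw: "f w = f x" using insert by (simp add: w_def)
    have wi: "w i = x i" using insert by (simp add: w_def)
    have eq: "(\<lambda>j. if j \<in> insert i T then y j else x j) = w(i := y i)"
      by (auto simp: w_def)
    have w': "w(i := y i) \<in> profiles n"
      by (rule updated_profile[OF w i yi])
    \<comment> \<open>Truthfulness is used in both directions: from \<open>x i\<close> the new
      outcome is no closer than the old one, and from \<open>y i\<close> it is no farther. As
      \<open>y i\<close> lies between \<open>x i\<close> and the old outcome, only the old outcome
      satisfies both, unless \<open>y i\<close> equals \<open>x i\<close>.\<close>
    have "dist (w i) (f w) \<le> dist (w i) (f (w(i := y i)))"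
      using f w i yi by (auto simp: strategyproof_def)
    moreover have "dist (y i) (f (w(i := y i))) \<le> dist (y i) (f ((w(i := y i))(i := x i)))"
      using f w' i xi by (auto simp: strategyproof_def dest!: bspec)
    moreover have "(w(i := y i))(i := x i) = w"
      using wi by auto
    ultimately have "f (w(i := y i)) = f x"
      using between[OF i] fw wi by (cases "x i = y i") (auto simp: dist_real_def abs_if split: if_splits)
    then show ?case by (simp only: eq)
  qed
  from this[of "{1..n}"] have "f (\<lambda>i. if i \<in> {1..n} then y i else x i) = f x"
    by simp
  moreover have "(\<lambda>i. if i \<in> {1..n} then y i else x i) = y"
    using x y by (auto simp: profiles_def PiE_iff extensional_def)
  ultimately show ?thesis by simp
qed

text \<open>Every agent that changes its report leaves from the same true location t, so the
  individual inequalities chain into one for the group.\<close>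

lemma strategyproof_group:
  assumes f: "strategyproof n f" and x: "x \<in> profiles n" and y: "y \<in> profiles n"
    and same: "\<And>i. i \<in> {1..n} \<Longrightarrow> x i \<noteq> y i \<Longrightarrow> x i = t"
  shows "dist t (f x) \<le> dist t (f y)"
proof -
  have "dist t (f x) \<le> dist t (f (\<lambda>i. if i \<in> T then y i else x i))" if "finite T" "T \<subseteq> {1..n}" for T
    using that
  proof (induction T rule: finite_induct)
    case empty
    then show ?case by simp
  next
    case (insert i T)
    define w where "w = (\<lambda>i. if i \<in> T then y i else x i)"
    have w: "w \<in> profiles n"
      using x y by (auto simp: w_def profiles_def PiE_iff extensional_def)
    have i: "i \<in> {1..n}" using insert by auto
    have yi: "y i \<in> {0..1}" using y i by (auto simp: profiles_def)
    have wi: "w i = x i" using insert by (simp add: w_def)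
    have eq: "(\<lambda>j. if j \<in> insert i T then y j else x j) = w(i := y i)"
      by (auto simp: w_def)
    have "dist (w i) (f w) \<le> dist (w i) (f (w(i := y i)))"
      using f w i yi by (auto simp: strategyproof_def)
    then have "dist t (f w) \<le> dist t (f (w(i := y i)))"
      using same[OF i] wi by (cases "x i = y i") (auto simp: fun_upd_idem)
    moreover have "dist t (f x) \<le> dist t (f w)"
      using insert by (simp add: w_def)
    ultimately show ?case by (simp only: eq)
  qed
  from this[of "{1..n}"] have "dist t (f x) \<le> dist t (f (\<lambda>i. if i \<in> {1..n} then y i else x i))"
    by simp
  moreover have "(\<lambda>i. if i \<in> {1..n} then y i else x i) = y"
    using x y by (auto simp: profiles_def PiE_iff extensional_def)
  ultimately show ?thesis by simp
qed

section \<open>Unanimous strategyproof mechanisms and their outcomes at 0/1 profiles\<close>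

locale unanimous_strategyproof =
  fixes n :: nat and f :: mechanism
  assumes mechanism: "f \<in> mechanisms n"
    and sp: "strategyproof n f"
    and unanimous: "0 \<le> t \<Longrightarrow> t \<le> 1 \<Longrightarrow> f (two_valued n {} t t) = t"
begin

lemma value_in: "x \<in> profiles n \<Longrightarrow> f x \<in> {0..1}"
  using mechanism by (auto simp: mechanisms_def)

text \<open>The outcome \<open>r t\<close>, as a function of the common location \<open>t\<close> of the lower group, is
  a best outcome for \<open>t\<close> among all values of \<open>r\<close>, and \<open>t \<le> r t \<le> c\<close> by unanimity. If \<open>r 0 \<noteq> c\<close>, let
  \<open>s < c\<close> be the supremum of the \<open>t\<close> with \<open>r t < c\<close>: some \<open>r t\<close> is close to \<open>s\<close>, so the group at
  a location slightly above \<open>s\<close> would prefer it to \<open>c\<close>.\<close>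

lemma two_valued_lower_group:
  assumes u: "0 \<le> u" "u < c" "c \<le> 1" and fu: "f (two_valued n S u c) = c"
  shows "f (two_valued n S 0 c) = c"
proof (rule ccontr)
  define r where "r t = f (two_valued n S t c)" for t
  assume "f (two_valued n S 0 c) \<noteq> c"
  then have r0: "r 0 \<noteq> c" by (simp add: r_def)
  have prof: "two_valued n T t s \<in> profiles n" if "0 \<le> t" "t \<le> c" "0 \<le> s" "s \<le> c" for s t T
    using that u by auto
  have lower: "t \<le> r t" if "0 \<le> t" "t \<le> c" for t
  proof (rule ccontr)
    assume *: "\<not> t \<le> r t"
    have "f (two_valued n {} t t) = f (two_valued n S t c)"
      using that u * by (intro strategyproof_invariant[OF sp] prof) (auto simp: r_def)
    then show False using * unanimous[of t] that u by (simp add: r_def)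
  qed
  have upper: "r t \<le> c" if "0 \<le> t" "t \<le> c" for t
  proof (rule ccontr)
    assume *: "\<not> r t \<le> c"
    have "f (two_valued n {} c c) = f (two_valued n S t c)"
      using that u * by (intro strategyproof_invariant[OF sp] prof) (auto simp: r_def)
    then show False using * unanimous[of c] that u by (simp add: r_def)
  qed
  have idem: "r (r t) = r t" if "0 \<le> t" "t \<le> c" for t
  proof -
    have "f (two_valued n S (r t) c) = f (two_valued n S t c)"
      using that u lower[OF that] upper[OF that]
      by (intro strategyproof_invariant[OF sp] prof) (auto simp: r_def)
    then show ?thesis by (simp add: r_def)
  qed
  have best: "\<bar>t - r t\<bar> \<le> \<bar>t - r s\<bar>" if "0 \<le> t" "t \<le> c" "0 \<le> s" "s \<le> c" for s t
  proof -
    have "dist t (f (two_valued n S t c)) \<le> dist t (f (two_valued n S s c))"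
      using that u by (intro strategyproof_group[OF sp] prof) (auto split: if_splits)
    then show ?thesis by (simp add: r_def dist_real_def)
  qed
  define E where "E = {t. 0 \<le> t \<and> t \<le> c \<and> r t < c}"
  have "0 \<in> E" using r0 u upper[of 0] by (auto simp: E_def)
  \<comment> \<open>For t > u in \<open>E\<close> the value \<open>r t\<close> would lie strictly
    between u and c, so the group at u would prefer it to \<open>r u = c\<close>.\<close>
  have E_le: "t \<le> u" if "t \<in> E" for t
    using that best[of u t] lower[of t] fu u by (fastforce simp: E_def r_def)
  then have bdd: "bdd_above E" by (rule bdd_aboveI)
  define s where "s = Sup E"
  \<comment> \<open>With a quarter of the gap, \<open>s + \<epsilon>\<close> is at distance 3
    \<open>\<epsilon>\<close> from c but less than 2 \<open>\<epsilon>\<close> from the value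
    \<open>r t\<close> found just below s.\<close>
  define \<epsilon> where "\<epsilon> = (c - s) / 4"
  have s: "0 \<le> s" "s \<le> u"
    unfolding s_def using \<open>0 \<in> E\<close> bdd E_le by (auto intro: cSup_upper cSup_least)
  then have \<epsilon>: "\<epsilon> > 0" using u by (simp add: \<epsilon>_def)
  then have "s - \<epsilon> < Sup E" by (simp add: s_def)
  then obtain t where t: "t \<in> E" "s - \<epsilon> < t"
    using less_cSupD[of E] \<open>0 \<in> E\<close> by blast
  have v: "r t \<in> E" "t \<le> r t"
    using t idem[of t] lower[of t] upper[of t] by (auto simp: E_def)
  then have "r t \<le> s" unfolding s_def using bdd by (auto intro: cSup_upper)
  have w: "0 \<le> s + \<epsilon>" "s + \<epsilon> < c" using s u \<epsilon> by (auto simp: \<epsilon>_def field_simps)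
  have "s + \<epsilon> \<notin> E" using \<epsilon> cSup_upper[OF _ bdd] by (force simp: s_def)
  then have "r (s + \<epsilon>) = c" using w upper[of "s + \<epsilon>"] by (auto simp: E_def)
  moreover have "\<bar>(s + \<epsilon>) - r (s + \<epsilon>)\<bar> \<le> \<bar>(s + \<epsilon>) - r (r t)\<bar>"
    using best[of "s + \<epsilon>" "r t"] v w by (auto simp: E_def)
  moreover have "r (r t) = r t" using idem[of t] t by (auto simp: E_def)
  ultimately show False using v t \<open>r t \<le> s\<close> w \<epsilon> by (auto simp: \<epsilon>_def field_simps)
qed

text \<open>The profile is pushed to a 0/1 profile in three moves: gather each side of the outcome,
  send the lower group to 0, then send the upper group from c to 1.\<close>

lemma value_le:
  assumes x: "x \<in> profiles n"
  shows "f x \<le> f (two_valued n {i\<in>{1..n}. f x \<le> x i} 0 1)"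
proof (cases "f x = 0")
  case True
  have "two_valued n {i\<in>{1..n}. f x \<le> x i} 0 1 \<in> profiles n" by auto
  then show ?thesis using value_in True by force
next
  case False
  define c where "c = f x"
  have c: "0 < c" "c \<le> 1" using value_in[OF x] False by (auto simp: c_def)
  define S where "S = {i\<in>{1..n}. c \<le> x i}"
  have x01: "x i \<in> {0..1}" if "i \<in> {1..n}" for i
    using x that by (auto simp: profiles_def)
  \<comment> \<open>The highest location below the outcome, or 0 if there is none. Raising the lower
    agents to u and lowering the others to c moves all of them towards the outcome.\<close>
  define u where "u = Max (insert 0 (x ` ({1..n} - S)))"
  have "u \<in> insert 0 (x ` ({1..n} - S))"
    unfolding u_def by (intro Max_in) auto
  then have u: "0 \<le> u" "u < c" using c x01 by (auto simp: S_def)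
  have ux: "x i \<le> u" if "i \<in> {1..n} - S" for i
    unfolding u_def using that by (intro Max_ge) auto
  have "f (two_valued n S u c) = f x"
    using u c ux
    by (intro strategyproof_invariant[OF sp] x two_valued_profiles) (auto simp: S_def c_def)
  \<comment> \<open>Going down to 0 leads away from the outcome, so
    \<open>strategyproof_invariant\<close> does not apply here.\<close>
  then have "f (two_valued n S 0 c) = c"
    using two_valued_lower_group[of u c S] u c by (simp add: c_def)
  moreover have "dist 1 (f (two_valued n S 0 1)) \<le> dist 1 (f (two_valued n S 0 c))"
    using c by (intro strategyproof_group[OF sp] two_valued_profiles) (auto split: if_splits)
  moreover have "f (two_valued n S 0 1) \<in> {0..1}" by (intro value_in) auto
  ultimately have "c \<le> f (two_valued n S 0 1)" using c by (auto simp: dist_real_def)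
  then show ?thesis by (simp add: S_def c_def)
qed

lemma two_valued_mono:
  assumes "S \<subseteq> S'"
  shows "f (two_valued n S 0 1) \<le> f (two_valued n S' 0 1)"
proof -
  have "dist 1 (f (two_valued n S' 0 1)) \<le> dist 1 (f (two_valued n S 0 1))"
    using assms by (intro strategyproof_group[OF sp] two_valued_profiles) (auto split: if_splits)
  moreover have "f (two_valued n S 0 1) \<in> {0..1}" "f (two_valued n S' 0 1) \<in> {0..1}"
    by (intro value_in two_valued_profiles; simp)+
  ultimately show ?thesis by (auto simp: dist_real_def)
qed

end

section \<open>Reflection of the interval, the dual bound, and the identification of rank
  mechanisms\<close>

definition reflect :: "nat \<Rightarrow> profile \<Rightarrow> profile" where
  "reflect n x = (\<lambda>i\<in>{1..n}. 1 - x i)"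

lemma reflect_profiles: "x \<in> profiles n \<Longrightarrow> reflect n x \<in> profiles n"
  by (auto simp: reflect_def profiles_def PiE_iff)

lemma reflect_reflect: "x \<in> profiles n \<Longrightarrow> reflect n (reflect n x) = x"
  by (auto simp: reflect_def profiles_def PiE_iff extensional_def)

lemma reflect_two_valued: "reflect n (two_valued n S a b) = two_valued n S (1 - a) (1 - b)"
  by (auto simp: reflect_def two_valued_def)

context unanimous_strategyproof
begin

text \<open>The map t to 1 - t is an isometry of [0,1], so all comparisons of distances survive
  conjugation by it.\<close>

lemma reflected: "unanimous_strategyproof n (\<lambda>x\<in>profiles n. 1 - f (reflect n x))"
proof
  show "(\<lambda>x\<in>profiles n. 1 - f (reflect n x)) \<in> mechanisms n"
    using value_in reflect_profiles by (fastforce simp: mechanisms_def)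
  show "strategyproof n (\<lambda>x\<in>profiles n. 1 - f (reflect n x))"
    unfolding strategyproof_def
  proof (intro ballI)
    fix x i and y :: real
    assume x: "x \<in> profiles n" and i: "i \<in> {1..n}" and y: "y \<in> {0..1}"
    have "reflect n (x(i := y)) = (reflect n x)(i := 1 - y)"
      using i by (auto simp: reflect_def)
    moreover have "reflect n x i = 1 - x i" using i by (simp add: reflect_def)
    moreover have "1 - y \<in> {0..1}" using y by auto
    then have "dist (reflect n x i) (f (reflect n x))
        \<le> dist (reflect n x i) (f ((reflect n x)(i := 1 - y)))"
      using sp reflect_profiles[OF x] i unfolding strategyproof_def by blast
    ultimately show "dist (x i) ((\<lambda>x\<in>profiles n. 1 - f (reflect n x)) x)
        \<le> dist (x i) ((\<lambda>x\<in>profiles n. 1 - f (reflect n x)) (x(i := y)))"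
      using x updated_profile[OF x i y] by (auto simp: dist_real_def abs_if split: if_splits)
  qed
  fix t :: real assume "0 \<le> t" "t \<le> 1"
  then show "(\<lambda>x\<in>profiles n. 1 - f (reflect n x)) (two_valued n {} t t) = t"
    using unanimous[of "1 - t"] by (auto simp: reflect_two_valued)
qed

lemma value_ge:
  assumes x: "x \<in> profiles n"
  shows "f (two_valued n {i\<in>{1..n}. f x < x i} 0 1) \<le> f x"
proof -
  interpret R: unanimous_strategyproof n "\<lambda>x\<in>profiles n. 1 - f (reflect n x)"
    by (rule reflected)
  let ?S = "{i\<in>{1..n}. 1 - f x \<le> reflect n x i}"
  have "1 - f x \<le> 1 - f (reflect n (two_valued n ?S 0 1))"
    using R.value_le[OF reflect_profiles[OF x]] reflect_profiles[OF x]
    by (simp add: reflect_reflect[OF x] two_valued_profiles)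
  \<comment> \<open>Reflection sends the agents of \<open>?S\<close>, those weakly below the
    outcome, to 0. The agents left at 1 are those strictly above it, which is why this bound has a
    strict inequality.\<close>
  moreover have "reflect n (two_valued n ?S 0 1) = two_valued n {i\<in>{1..n}. f x < x i} 0 1"
    by (auto simp: reflect_def two_valued_def)
  ultimately show ?thesis by simp
qed

text \<open>For an outcome strictly between 0 and 1/2 both bounds refer to the set \<open>S\<close>
  and pin down the value. At 0 and at 1/2 one of them suffices, and above 1/2 the upper set is
  empty, contradicting unanimity at 0.\<close>

lemma two_valued_half:
  assumes S: "S \<subseteq> {1..n}"
  shows "f (two_valued n S 0 (1/2)) = min (f (two_valued n S 0 1)) (1/2)"
proof -
  let ?x = "two_valued n S 0 (1/2)"
  have x: "?x \<in> profiles n" by auto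
  define c where "c = f ?x"
  have c: "0 \<le> c" "c \<le> 1" using value_in[OF x] by (auto simp: c_def)
  have p: "f (two_valued n S 0 1) \<in> {0..1}" by (intro value_in) auto
  have *: "c \<le> f (two_valued n {i\<in>{1..n}. c \<le> ?x i} 0 1)"
    "f (two_valued n {i\<in>{1..n}. c < ?x i} 0 1) \<le> c"
    using value_le[OF x] value_ge[OF x] by (auto simp: c_def)
  consider "c = 0" | "0 < c" "c < 1/2" | "c = 1/2" | "1/2 < c" using c by linarith
  then show ?thesis
  proof cases
    case 1
    then have "{i\<in>{1..n}. c < ?x i} = S" using S by (auto split: if_splits)
    with * 1 p show ?thesis by (auto simp: c_def)
  next
    case 2
    then have "{i\<in>{1..n}. c < ?x i} = S" "{i\<in>{1..n}. c \<le> ?x i} = S" using S by (auto split: if_splits)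
    with * 2 show ?thesis by (auto simp: c_def)
  next
    case 3
    then have "{i\<in>{1..n}. c \<le> ?x i} = S" using S by (auto split: if_splits)
    with * 3 show ?thesis by (auto simp: c_def)
  next
    case 4
    then have "{i\<in>{1..n}. c \<le> ?x i} = {}" by auto
    moreover have "two_valued n {} 0 1 = two_valued n {} 0 0" by (simp add: two_valued_def)
    ultimately have "c \<le> f (two_valued n {} 0 0)" using *(1) by (simp only:)
    with 4 unanimous[of 0] show ?thesis by simp
  qed
qed

lemma eq_rank_mechanism:
  assumes anon: "anonymous n f"
    and ext: "\<And>S. S \<subseteq> {1..n} \<Longrightarrow> f (two_valued n S 0 1) \<in> {0, 1}"
  shows "\<exists>k\<in>{1..n}. f = rank_mechanism n k"
proof -
  define p where "p j = f (two_valued n {1..j} 0 1)" for j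
  have pn: "p n = 1"
  proof -
    have "two_valued n {1..n} 0 1 = two_valued n {} 1 1" by (auto simp: two_valued_def)
    then show ?thesis using unanimous[of 1] by (simp add: p_def)
  qed
  have p0: "p 0 = 0"
  proof -
    have "two_valued n {1..0} 0 1 = two_valued n {} 0 0" by (auto simp: two_valued_def)
    then show ?thesis using unanimous[of 0] by (simp add: p_def)
  qed
  define j where "j = (LEAST j. p j = 1)"
  have pj: "p j = 1" and jn: "j \<le> n"
    unfolding j_def using pn by (auto intro: LeastI Least_le)
  have "j \<noteq> 0" using pj p0 by (metis zero_neq_one)
  \<comment> \<open>As j is the least number of agents at 1 that yields outcome 1, this choice
    matches the threshold in \<open>rank_mechanism_two_valued\<close>.\<close>
  define k where "k = n + 1 - j"
  have k: "k \<in> {1..n}" "n < k + l \<longleftrightarrow> j \<le> l" for l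
    using jn \<open>j \<noteq> 0\<close> by (auto simp: k_def)
  have p_iff: "p l = 1 \<longleftrightarrow> j \<le> l" for l
  proof
    show "j \<le> l" if "p l = 1" using that unfolding j_def by (rule Least_le)
    assume "j \<le> l"
    then have "1 \<le> p l" using two_valued_mono[of "{1..j}" "{1..l}"] pj by (auto simp: p_def)
    moreover have "p l \<in> {0..1}" unfolding p_def by (intro value_in) auto
    ultimately show "p l = 1" by auto
  qed
  have pS: "f (two_valued n S 0 1) = (if n < k + card S then 1 else 0)" if "S \<subseteq> {1..n}" for S
  proof -
    have "card S \<le> n" using card_mono[OF _ that] by simp
    then have "f (two_valued n S 0 1) = p (card S)"
      unfolding p_def using that by (intro anonymous_two_valued[OF anon]) auto
    with p_iff[of "card S"] ext[OF that] show ?thesis by (auto simp: k)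
  qed
  have "f x = rank_mechanism n k x" if x: "x \<in> profiles n" for x
  proof (rule rank_mechanism_eqI[OF x k(1), symmetric])
    define c where "c = f x"
    have c: "0 \<le> c" "c \<le> 1" using value_in[OF x] by (auto simp: c_def)
    then show "0 \<le> f x" "f x \<le> 1" by (auto simp: c_def)
    have compl: "card {i\<in>{1..n}. \<not> P i} + card {i\<in>{1..n}. P i} = n" for P
    proof -
      have "card ({i\<in>{1..n}. \<not> P i} \<union> {i\<in>{1..n}. P i}) =
          card {i\<in>{1..n}. \<not> P i} + card {i\<in>{1..n}. P i}"
        by (rule card_Un_disjoint) auto
      moreover have "{i\<in>{1..n}. \<not> P i} \<union> {i\<in>{1..n}. P i} = {1..n}" by auto
      ultimately show ?thesis by simp
    qed
    fix y :: real assume y: "0 \<le> y" "y \<le> 1"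
    have mono: "card {i\<in>{1..n}. x i \<le> a} \<le> card {i\<in>{1..n}. x i \<le> b}" if "a \<le> b" for a b
      using that by (intro card_mono) auto
    show "f x \<le> y \<longleftrightarrow> k \<le> card {i\<in>{1..n}. x i \<le> y}"
    \<comment> \<open>Below 1, \<open>value_ge\<close> and \<open>value_le\<close> make the outcomes
      at the strict and weak upper sets differ from 1 and 0 respectively; being extreme they are
      then known, and \<open>pS\<close> turns them into counts. At y = 1 the first step would
      fail.\<close>
    proof (cases "y = 1")
      case True
      then have "{i\<in>{1..n}. x i \<le> y} = {1..n}" using x by (auto simp: profiles_def)
      then show ?thesis using True c k by (auto simp: c_def)
    next
      case y1: False
      show ?thesis
      proof (cases "c \<le> y")
        case True
        have "f (two_valued n {i\<in>{1..n}. c < x i} 0 1) < 1"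
          using value_ge[OF x] y y1 True by (simp add: c_def)
        then have "\<not> n < k + card {i\<in>{1..n}. c < x i}" by (subst (asm) pS) (auto split: if_splits)
        then have "k \<le> card {i\<in>{1..n}. x i \<le> c}"
          using compl[of "\<lambda>i. x i \<le> c"] by (simp add: not_le)
        then show ?thesis using mono[OF True] True by (simp add: c_def)
      next
        case False
        have "0 < f (two_valued n {i\<in>{1..n}. c \<le> x i} 0 1)"
          using value_le[OF x] y False by (simp add: c_def)
        then have "n < k + card {i\<in>{1..n}. c \<le> x i}" by (subst (asm) pS) (auto split: if_splits)
        then have "card {i\<in>{1..n}. x i < c} < k"
          using compl[of "\<lambda>i. c \<le> x i"] by (simp add: not_le)
        moreover have "card {i\<in>{1..n}. x i \<le> y} \<le> card {i\<in>{1..n}. x i < c}"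
          using False by (intro card_mono) auto
        ultimately show ?thesis using False by (simp add: c_def)
      qed
    qed
  qed
  moreover have "f x = rank_mechanism n k x" if "x \<notin> profiles n" for x
    using that PiE_arb[OF mechanism[unfolded mechanisms_def]] by (simp add: rank_mechanism_def)
  ultimately have "f = rank_mechanism n k" by blast
  then show ?thesis using k(1) by blast
qed

end


section \<open>Random mechanisms\<close>

lemma strongly_proportionalD:
  assumes "strongly_proportional_in_expectation n M"
    and "0 \<le> a" "a < b" "b \<le> 1" "x \<in> {1..n} \<rightarrow>\<^sub>E {a, b}"
    and "T \<subseteq> {1..n}" "\<forall>i\<in>T. \<forall>j\<in>T. x i = x j" "i \<in> T"
  shows "(\<integral>f. dist (x i) (f x) \<partial>M) \<le> (real n - real (card T)) / real n * (b - a)"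
  by (rule assms(1)[unfolded strongly_proportional_in_expectation_def, rule_format, of a b x T i])
     (use assms in blast)+

locale random_mechanism = prob_space M for n :: nat and M :: "mechanism measure" +
  assumes space: "space M = mechanisms n"
    and evaluation: "x \<in> profiles n \<Longrightarrow> (\<lambda>f. f x) \<in> borel_measurable M"
    and n_pos: "1 \<le> n"
begin

lemma value_in: "f \<in> space M \<Longrightarrow> x \<in> profiles n \<Longrightarrow> f x \<in> {0..1}"
  by (auto simp: space mechanisms_def)

lemma integrable_evaluation:
  assumes "x \<in> profiles n"
  shows "integrable M (\<lambda>f. f x)"
  by (rule integrable_const_bound[where B = 1])
     (use value_in[OF _ assms] evaluation[OF assms] in auto)

text \<open>The group at b bounds the mean from below and the group at 0 bounds it from above, and
  the two bounds coincide.\<close>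

lemma expectation_two_valued:
  assumes proportional: "strongly_proportional_in_expectation n M"
    and S: "S \<subseteq> {1..n}" and b: "0 < b" "b \<le> 1"
  shows "expectation (\<lambda>f. f (two_valued n S 0 b)) = b * card S / n"
proof (rule antisym)
  let ?x = "two_valued n S 0 b"
  have x: "?x \<in> profiles n" using b by auto
  note int = integrable_evaluation[OF x]
  have bound: "expectation (\<lambda>f. dist (?x i) (f ?x)) \<le> (real n - real (card T)) / real n * b"
    if "T \<subseteq> {1..n}" "i \<in> T" "T \<subseteq> S \<or> T \<inter> S = {}" for i T
  proof -
    have "\<forall>i\<in>T. \<forall>j\<in>T. ?x i = ?x j" using that by (auto simp: subset_iff)
    from strongly_proportionalD[OF proportional order_refl b two_valued_PiE that(1) this that(2)]
    show ?thesis by simp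
  qed
  have cS: "card ({1..n} - S) = n - card S" "card S \<le> n"
    using S card_mono[OF _ S] finite_subset[OF S] by (auto simp: card_Diff_subset)
  have at_b: "b - expectation (\<lambda>f. f ?x) \<le> (real n - real (card S)) / real n * b" if "i \<in> S" for i
  proof -
    have "b - expectation (\<lambda>f. f ?x) = expectation (\<lambda>f. b - f ?x)"
      using int by (simp add: prob_space)
    also have "\<dots> \<le> expectation (\<lambda>f. dist (?x i) (f ?x))"
      using int S that by (intro integral_mono) (auto simp: dist_real_def)
    finally show ?thesis using bound[OF S that] by simp
  qed
  \<comment> \<open>Needed when all agents are at b: no agent at 0 then supplies the upper
    bound.\<close>
  have upper_b: "expectation (\<lambda>f. f ?x) - b \<le> (real n - real (card S)) / real n * b" if "i \<in> S" for i
  proof -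
    have "expectation (\<lambda>f. f ?x) - b = expectation (\<lambda>f. f ?x - b)"
      using int by (simp add: prob_space)
    also have "\<dots> \<le> expectation (\<lambda>f. dist (?x i) (f ?x))"
      using int S that by (intro integral_mono) (auto simp: dist_real_def)
    finally show ?thesis using bound[OF S that] by simp
  qed
  show "b * card S / n \<le> expectation (\<lambda>f. f ?x)"
  proof (cases "S = {}")
    case True
    have "0 \<le> expectation (\<lambda>f. f ?x)"
      using value_in[OF _ x] by (intro integral_nonneg_AE) auto
    with True show ?thesis by simp
  next
    case False
    then obtain i where "i \<in> S" by blast
    from at_b[OF this] show ?thesis using n_pos by (simp add: field_simps)
  qed
  show "expectation (\<lambda>f. f ?x) \<le> b * card S / n"
  proof (cases "S = {1..n}")
    case True
    then have "1 \<in> S" using n_pos by simp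
    from upper_b[OF this] show ?thesis using n_pos True by simp
  next
    case False
    then obtain i where i: "i \<in> {1..n} - S" using S by blast
    have "expectation (\<lambda>f. f ?x) \<le> expectation (\<lambda>f. dist (?x i) (f ?x))"
      using int i by (intro integral_mono) (auto simp: dist_real_def)
    also have "\<dots> \<le> (real n - real (card ({1..n} - S))) / real n * b"
      using i by (intro bound) auto
    finally show ?thesis using cS by (simp add: of_nat_diff field_simps)
  qed
qed

text \<open>Strategyproofness makes the distance between \<open>t\<close> and the outcome at the constant profile
  \<open>t\<close> at most \<open>\<bar>t - q\<bar>\<close> for each rational \<open>q\<close>, so countably many null sets suffice.\<close>

lemma AE_unanimous_strategyproof:
  assumes truthful: "universally_truthful n M"
    and proportional: "strongly_proportional_in_expectation n M"
  shows "AE f in M. unanimous_strategyproof n f"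
proof -
  have rational: "AE f in M. f (two_valued n {} t t) = t" if t: "t \<in> {0..1}" for t
  proof -
    let ?x = "two_valued n {} t t"
    have x: "?x \<in> profiles n" using t by auto
    \<comment> \<open>The proportionality condition speaks of two distinct locations, so t is
      completed to such a pair; the group of all agents then has expected distance 0.\<close>
    obtain a b where ab: "0 \<le> a" "a < b" "b \<le> 1" "t \<in> {a, b}"
    proof (cases "t = 0")
      case True
      then show ?thesis using that[of 0 1] by simp
    next
      case False
      then show ?thesis using that[of 0 t] t by simp
    qed
    have "?x \<in> {1..n} \<rightarrow>\<^sub>E {a, b}" using ab by (auto simp: two_valued_def)
    moreover have "\<forall>i\<in>{1..n}. \<forall>j\<in>{1..n}. ?x i = ?x j" by simp
    moreover have "1 \<in> {1..n}" using n_pos by simp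
    ultimately have "expectation (\<lambda>f. dist (?x 1) (f ?x))
        \<le> (real n - real (card {1..n})) / real n * (b - a)"
      using strongly_proportionalD[OF proportional ab(1-3)] by blast
    then have le: "expectation (\<lambda>f. dist t (f ?x)) \<le> 0" using n_pos by simp
    have int: "integrable M (\<lambda>f. dist t (f ?x))"
      using integrable_evaluation[OF x] by (auto simp: dist_real_def)
    have "expectation (\<lambda>f. dist t (f ?x)) = 0"
      by (rule antisym[OF le]) simp
    then have "AE f in M. dist t (f ?x) = 0"
      using integral_nonneg_eq_0_iff_AE[OF int] by simp
    then show ?thesis by eventually_elim simp
  qed
  have "AE f in M. \<forall>q\<in>\<rat> \<inter> {0..1}. f (two_valued n {} q q) = q"
    using rational by (subst AE_ball_countable) (auto intro: countable_subset[OF _ countable_rat])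
  with truthful[unfolded universally_truthful_def] AE_space show ?thesis
  proof eventually_elim
    case (elim f)
    show ?case
    proof
      show "f \<in> mechanisms n" "strategyproof n f" using elim by (auto simp: space)
      fix t :: real assume t: "0 \<le> t" "t \<le> 1"
      let ?v = "f (two_valued n {} t t)"
      have near: "\<bar>t - ?v\<bar> \<le> \<bar>t - q\<bar>" if "q \<in> \<rat> \<inter> {0..1}" for q
      proof -
        have "dist t ?v \<le> dist t (f (two_valued n {} q q))"
          using elim that t by (intro strategyproof_group two_valued_profiles) auto
        then show ?thesis using elim that by (simp add: dist_real_def)
      qed
      show "?v = t"
      proof (rule ccontr)
        assume "?v \<noteq> t"
        then have d: "0 < \<bar>t - ?v\<bar>" by simp
        have "\<exists>q\<in>\<rat> \<inter> {0..1}. \<bar>t - q\<bar> < \<bar>t - ?v\<bar>"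
        \<comment> \<open>A rational just above t stays in [0,1] only for t < 1; at the endpoint, 1
          itself serves.\<close>
        proof (cases "t = 1")
          case True
          then show ?thesis using d by (intro bexI[of _ 1]) auto
        next
          case False
          then obtain q where "q \<in> \<rat>" "t < q" "q < min 1 (t + \<bar>t - ?v\<bar>)"
            using Rats_dense_in_real[of t "min 1 (t + \<bar>t - ?v\<bar>)"] t d by auto
          then show ?thesis using t by (intro bexI[of _ q]) auto
        qed
        with near show False by force
      qed
    qed
  qed
qed

text \<open>With \<open>p\<close> the outcome at the profile with values \<open>0\<close>, \<open>1\<close>, the outcome with \<open>1\<close> replaced by
  \<open>1/2\<close> is \<open>min p (1/2)\<close>; both means are prescribed, so \<open>min p (1/2) - p/2\<close> has mean \<open>0\<close>,
  but it is positive unless \<open>p\<close> is \<open>0\<close> or \<open>1\<close>.\<close>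

lemma AE_two_valued_extreme:
  assumes truthful: "universally_truthful n M"
    and proportional: "strongly_proportional_in_expectation n M"
    and S: "S \<subseteq> {1..n}"
  shows "AE f in M. f (two_valued n S 0 1) \<in> {0, 1}"
proof -
  let ?x = "two_valued n S 0 1" and ?y = "two_valued n S 0 (1/2)"
  have int: "integrable M (\<lambda>f. f ?x)" "integrable M (\<lambda>f. f ?y)"
    by (auto intro!: integrable_evaluation)
  have us: "AE f in M. unanimous_strategyproof n f"
    by (rule AE_unanimous_strategyproof[OF truthful proportional])
  have gap: "AE f in M. f ?y = min (f ?x) (1/2) \<and> f ?x \<in> {0..1}"
    using us AE_space
  proof eventually_elim
    case (elim f)
    show ?case
      using unanimous_strategyproof.two_valued_half[OF elim(1) S]
        value_in[OF elim(2) two_valued_profiles[of 0 1 n S]] by auto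
  qed
  have "expectation (\<lambda>f. f ?y - f ?x / 2) = 0"
    using int expectation_two_valued[OF proportional S, of 1] expectation_two_valued[OF proportional S, of "1/2"]
    by simp
  moreover have "integrable M (\<lambda>f. f ?y - f ?x / 2)" using int by simp
  moreover have "AE f in M. 0 \<le> f ?y - f ?x / 2"
    using gap by eventually_elim auto
  ultimately have "AE f in M. f ?y - f ?x / 2 = 0"
    using integral_nonneg_eq_0_iff_AE by blast
  with gap show ?thesis
    by eventually_elim (auto simp: min_def split: if_splits)
qed

lemma AE_rank_mechanism:
  assumes anonymous: "universally_anonymous n M"
    and truthful: "universally_truthful n M"
    and proportional: "strongly_proportional_in_expectation n M"
  shows "AE f in M. f \<in> rank_mechanism n ` {1..n}"
proof -
  have "AE f in M. \<forall>S\<in>Pow {1..n}. f (two_valued n S 0 1) \<in> {0, 1}"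
    using AE_two_valued_extreme[OF truthful proportional]
    by (subst AE_ball_countable) (auto intro: countable_finite)
  with anonymous[unfolded universally_anonymous_def] AE_unanimous_strategyproof[OF truthful proportional]
  show ?thesis
  proof eventually_elim
    case (elim f)
    then show ?case
      using unanimous_strategyproof.eq_rank_mechanism[of n f] by auto
  qed
qed

text \<open>Singletons need not be events of \<open>M\<close>, but each rank is almost surely
  singled out by two evaluations, and the completion contains every set almost surely equal to an
  event. The mean of an outcome in {0, 1} gives the probability.\<close>

lemma rank_mechanism_mass:
  assumes ranks: "AE f in M. f \<in> rank_mechanism n ` {1..n}"
    and proportional: "strongly_proportional_in_expectation n M"
    and k: "k \<in> {1..n}"
  shows "{rank_mechanism n k} \<in> sets (completion M)"
    and "emeasure (completion M) {rank_mechanism n k} = ennreal (1 / n)"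
proof -
  define A where "A j = {f\<in>space M. f (two_valued n {1..j} 0 1) = 1}" for j
  have A: "A j \<in> sets M" for j
    unfolding A_def by (intro borel_measurable_eq evaluation two_valued_profiles) auto
  have rank_A: "rank_mechanism n l \<in> A j \<longleftrightarrow> n < l + j" if "l \<in> {1..n}" "j \<le> n" for l j
    using that rank_mechanism_mechanisms[OF that(1)] rank_mechanism_two_valued[OF that(1), of "{1..j}" 0 1]
    by (auto simp: A_def space)
  have prob_A: "prob (A j) = j / n" if "j \<le> n" for j
  proof -
    have "AE f in M. f (two_valued n {1..j} 0 1) = indicator (A j) f"
      using ranks AE_space
    proof eventually_elim
      case (elim f)
      then obtain l where "l \<in> {1..n}" "f = rank_mechanism n l" by auto
      then show ?case
        using that rank_mechanism_two_valued[of l n "{1..j}" 0 1] elim(2)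
        by (auto simp: A_def indicator_def)
    qed
    then have "expectation (\<lambda>f. f (two_valued n {1..j} 0 1)) = expectation (indicator (A j))"
      using A by (intro integral_cong_AE evaluation two_valued_profiles) auto
    then show ?thesis
      using expectation_two_valued[OF proportional, of "{1..j}" 1] that A by simp
  qed
  \<comment> \<open>Among rank mechanisms, \<open>?B\<close> holds those of rank at least k and
    \<open>?C\<close> those of rank above k.\<close>
  let ?B = "A (n + 1 - k)" and ?C = "A (n - k)" and ?r = "rank_mechanism n k"
  have rank_B: "rank_mechanism n l \<in> ?B \<longleftrightarrow> k \<le> l" if "l \<in> {1..n}" for l
    using rank_A[OF that, of "n + 1 - k"] k by fastforce
  have rank_C: "rank_mechanism n l \<in> ?C \<longleftrightarrow> k < l" if "l \<in> {1..n}" for l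
    using rank_A[OF that, of "n - k"] k by fastforce
  have BC: "?B - ?C \<in> sets M" using A by auto
  have eq: "AE f in M. f \<in> ?B - ?C \<longleftrightarrow> f \<in> {?r}"
    using ranks
  proof eventually_elim
    case (elim f)
    then obtain l where l: "l \<in> {1..n}" "f = rank_mechanism n l" by auto
    then have "f \<in> ?B - ?C \<longleftrightarrow> l = k"
      using rank_B[OF l(1)] rank_C[OF l(1)] by auto
    also have "\<dots> \<longleftrightarrow> f = ?r"
      using inj_on_eq_iff[OF inj_on_rank_mechanism l(1) k] l(2) by simp
    finally show ?case by simp
  qed
  have sub: "AE f in M. f \<in> ?C \<longrightarrow> f \<in> ?B \<inter> ?C"
    using ranks
  proof eventually_elim
    case (elim f)
    then obtain l where l: "l \<in> {1..n}" "f = rank_mechanism n l" by auto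
    then show ?case
      using rank_B[OF l(1)] rank_C[OF l(1)] by auto
  qed
  \<comment> \<open>The inclusion of \<open>?C\<close> in \<open>?B\<close> is only almost sure,
    since other mechanisms need not be monotone.\<close>
  have "prob (?B \<inter> ?C) = prob ?C"
    using A sub by (intro finite_measure_eq_AE) auto
  then have "prob (?B - ?C) = prob ?B - prob ?C"
    using A by (simp add: finite_measure_Diff')
  also have "\<dots> = 1 / n"
  proof -
    have "n + 1 - k \<le> n" "n - k \<le> n" "real (n + 1 - k) = real (n - k) + 1"
      using k by auto
    then show ?thesis
      by (simp only: prob_A) (simp add: diff_divide_distrib[symmetric])
  qed
  finally have prob_BC: "prob (?B - ?C) = 1 / n" .
  have eq': "AE f in completion M. f \<in> ?B - ?C \<longleftrightarrow> f \<in> {?r}"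
    using eq by (rule AE_completion)
  have r: "?r \<in> space M" using rank_mechanism_mechanisms[OF k] by (simp add: space)
  show r_sets: "{?r} \<in> sets (completion M)"
    using completion.in_sets_AE[OF eq'] BC r by auto
  have "emeasure (completion M) {?r} = emeasure (completion M) (?B - ?C)"
    using eq' BC r_sets by (intro emeasure_eq_AE) auto
  also have "\<dots> = emeasure M (?B - ?C)" using BC by simp
  finally show "emeasure (completion M) {?r} = ennreal (1 / n)"
    by (simp only: emeasure_eq_measure prob_BC)
qed

end

section \<open>The Random Rank distribution and the equivalence\<close>

lemma sets_random_rank: "sets (random_rank n) = Pow (mechanisms n)"
  by (simp add: random_rank_def)

lemma rank_mechanism_measurable:
  "rank_mechanism n \<in> uniform_count_measure {1..n} \<rightarrow>\<^sub>M count_space (mechanisms n)"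
  using rank_mechanism_mechanisms[of _ n]
  by (auto simp: measurable_def sets_uniform_count_measure space_uniform_count_measure)

lemma emeasure_random_rank:
  assumes "A \<subseteq> mechanisms n" "1 \<le> n"
  shows "emeasure (random_rank n) A = ennreal (card {k\<in>{1..n}. rank_mechanism n k \<in> A} / n)"
proof -
  have "rank_mechanism n -` A \<inter> space (uniform_count_measure {1..n}) =
      {k\<in>{1..n}. rank_mechanism n k \<in> A}"
    by (auto simp: space_uniform_count_measure)
  with assms have "emeasure (random_rank n) A =
      emeasure (uniform_count_measure {1..n}) {k\<in>{1..n}. rank_mechanism n k \<in> A}"
    unfolding random_rank_def by (subst emeasure_distr[OF rank_mechanism_measurable]) auto
  also have "\<dots> = ennreal (card {k\<in>{1..n}. rank_mechanism n k \<in> A} / card {1..n})"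
    by (rule emeasure_uniform_count_measure) auto
  finally show ?thesis by simp
qed

lemma AE_random_rank:
  assumes "\<And>k. k \<in> {1..n} \<Longrightarrow> P (rank_mechanism n k)"
  shows "AE f in random_rank n. P f"
  unfolding random_rank_def using rank_mechanism_measurable
  by (subst AE_distr_iff) (auto simp: space_uniform_count_measure assms intro!: AE_I2)

lemma integral_random_rank:
  fixes g :: "mechanism \<Rightarrow> real"
  shows "integral\<^sup>L (random_rank n) g = (\<Sum>k\<in>{1..n}. g (rank_mechanism n k)) / n"
  unfolding random_rank_def using rank_mechanism_measurable
  by (subst integral_distr) (auto simp: integral_uniform_count_measure)

lemma strongly_proportional_random_rank:
  assumes ab: "0 \<le> a" "a < b" "b \<le> 1" and x: "x \<in> {1..n} \<rightarrow>\<^sub>E {a, b}"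
    and T: "T \<subseteq> {1..n}" "\<forall>i\<in>T. \<forall>j\<in>T. x i = x j" and i: "i \<in> T"
  shows "(\<integral>f. dist (x i) (f x) \<partial>random_rank n) \<le> (real n - real (card T)) / real n * (b - a)"
proof -
  define S where "S = {i\<in>{1..n}. x i = b}"
  have S: "S \<subseteq> {1..n}" by (auto simp: S_def)
  have x_eq: "x = two_valued n S a b"
  proof
    fix i
    show "x i = two_valued n S a b i"
      using x by (cases "i \<in> {1..n}") (auto simp: S_def two_valued_def PiE_iff extensional_def)
  qed
  have cS: "card ({1..n} - S) = n - card S" "card S \<le> n"
    using S card_mono[OF _ S] finite_subset[OF S] by (auto simp: card_Diff_subset)
  have "i \<in> {1..n}" using T(1) i by blast
  have same: "x t = x i" if "t \<in> T" for t using T(2) i that by blast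
  have val: "rank_mechanism n k x = (if n < k + card S then b else a)" if "k \<in> {1..n}" for k
    unfolding x_eq by (rule rank_mechanism_two_valued[OF that S ab])
  have xi: "x i = (if i \<in> S then b else a)"
    using \<open>i \<in> {1..n}\<close> by (subst x_eq) simp
  \<comment> \<open>These ranks select the location other than \<open>x i\<close>. Their number is n
    minus the number of agents located with i, and \<open>T\<close> consists of such agents.\<close>
  let ?U = "if i \<in> S then {k\<in>{1..n}. \<not> n < k + card S} else {k\<in>{1..n}. n < k + card S}"
  have "(\<Sum>k\<in>{1..n}. dist (x i) (rank_mechanism n k x)) = (\<Sum>k\<in>{1..n}. if k \<in> ?U then b - a else 0)"
    using ab by (intro sum.cong) (auto simp: val xi dist_real_def)
  also have "\<dots> = (\<Sum>k\<in>{1..n} \<inter> ?U. b - a)"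
    by (rule sum.inter_restrict[symmetric]) simp
  also have "{1..n} \<inter> ?U = ?U" by auto
  also have "(\<Sum>k\<in>?U. b - a) = card ?U * (b - a)" by (rule sum_constant)
  also have "\<dots> \<le> (real n - real (card T)) * (b - a)"
  proof (rule mult_right_mono)
    show "real (card ?U) \<le> real n - real (card T)"
    proof (cases "i \<in> S")
      case True
      then have "T \<subseteq> S" using T(1) same by (auto simp: S_def)
      then have "card T \<le> card S" using finite_subset[OF S] card_mono by blast
      moreover have "?U = {1..n - card S}" using True cS by auto
      ultimately show ?thesis using cS by simp
    next
      case False
      then have "T \<subseteq> {1..n} - S" using T(1) same \<open>i \<in> {1..n}\<close> by (auto simp: S_def)
      then have "card T \<le> n - card S" using card_mono[of "{1..n} - S" T] cS by simp
      moreover have "?U = {n - card S<..n}" using False cS by auto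
      ultimately show ?thesis using cS by simp
    qed
  qed (use ab in simp)
  finally show ?thesis
    unfolding integral_random_rank by (simp add: divide_right_mono)
qed

theorem theorem3:
  fixes n :: nat and M :: "mechanism measure"
  assumes "n \<ge> 2"
    and "randomized_mechanism n M"
  shows "universally_anonymous n M \<and> universally_truthful n M \<and>
           strongly_proportional_in_expectation n M
         \<longleftrightarrow> completion M = random_rank n"
proof -
  interpret prob_space M using assms by (simp add: randomized_mechanism_def)
  interpret random_mechanism n M
    using assms by unfold_locales (auto simp: randomized_mechanism_def)
  show ?thesis
  proof (intro iffI; (elim conjE)?)
    assume anonymous: "universally_anonymous n M" and truthful: "universally_truthful n M"
      and proportional: "strongly_proportional_in_expectation n M"
    let ?G = "rank_mechanism n ` {1..n}"
    have ranks: "AE f in M. f \<in> ?G"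
      by (rule AE_rank_mechanism[OF anonymous truthful proportional])
    note mass = rank_mechanism_mass[OF ranks proportional]
    have ranks': "AE f in completion M. f \<in> ?G" using ranks by (rule AE_completion)
    have finite_sets: "B \<in> sets (completion M)" if "B \<subseteq> ?G" for B
    proof -
      have "(\<Union>f\<in>B. {f}) \<in> sets (completion M)"
        using that mass(1) finite_subset[OF that] by (intro sets.finite_UN) auto
      then show ?thesis by simp
    qed
    \<comment> \<open>Up to a null set every set of mechanisms is a finite set of rank mechanisms,
      so the completed sigma-algebra is the full power set.\<close>
    have all_sets: "A \<in> sets (completion M)" if A: "A \<subseteq> mechanisms n" for A
    proof -
      have G: "A \<inter> ?G \<in> sets (completion M)" by (rule finite_sets) auto
      have "AE f in completion M. f \<in> A \<inter> ?G \<longleftrightarrow> f \<in> A"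
        using ranks' by eventually_elim auto
      then show ?thesis
        by (rule completion.in_sets_AE[OF _ G]) (simp add: space A)
    qed
    show "completion M = random_rank n"
    proof (rule measure_eqI)
      show sets_eq: "sets (completion M) = sets (random_rank n)"
        using all_sets sets.space_closed[of "completion M"] by (auto simp: sets_random_rank space)
      fix A assume A: "A \<in> sets (completion M)"
      then have A': "A \<subseteq> mechanisms n" using sets.sets_into_space[OF A] by (simp add: space)
      let ?K = "{k\<in>{1..n}. rank_mechanism n k \<in> A}"
      have im: "A \<inter> ?G = rank_mechanism n ` ?K" by auto
      have "emeasure (completion M) A = emeasure (completion M) (A \<inter> ?G)"
        using ranks' A finite_sets by (intro emeasure_eq_AE) auto
      also have "\<dots> = (\<Sum>f\<in>rank_mechanism n ` ?K. emeasure (completion M) {f})"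
        unfolding im using mass(1) by (intro emeasure_eq_sum_singleton) auto
      also have "\<dots> = (\<Sum>k\<in>?K. emeasure (completion M) {rank_mechanism n k})"
        by (rule sum.reindex_cong[OF inj_on_subset[OF inj_on_rank_mechanism]]) auto
      also have "\<dots> = (\<Sum>k\<in>?K. ennreal (1 / n))"
        by (intro sum.cong) (auto simp: mass(2))
      also have "\<dots> = ennreal (card ?K / n)"
        by (simp add: sum_ennreal del: sum_constant) (simp add: divide_inverse)
      also have "\<dots> = emeasure (random_rank n) A"
        using A' n_pos by (subst emeasure_random_rank) auto
      finally show "emeasure (completion M) A = emeasure (random_rank n) A" .
    qed
  next
    assume eq: "completion M = random_rank n"
    have AE: "AE f in M. P f" if "\<And>k. k \<in> {1..n} \<Longrightarrow> P (rank_mechanism n k)" for P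
    proof -
      have "AE f in completion M. P f"
        unfolding eq by (rule AE_random_rank) (rule that)
      then show ?thesis by (simp only: AE_completion_iff)
    qed
    show "universally_anonymous n M \<and> universally_truthful n M \<and>
        strongly_proportional_in_expectation n M"
    proof (intro conjI)
      show "universally_anonymous n M"
        unfolding universally_anonymous_def by (intro AE anonymous_rank_mechanism)
      show "universally_truthful n M"
        unfolding universally_truthful_def by (intro AE strategyproof_rank_mechanism)
      have "(\<integral>f. dist (x i) (f x) \<partial>M) \<le> (real n - real (card T)) / real n * (b - a)"
        if ab: "0 \<le> a" "a < b" "b \<le> 1" and x: "x \<in> {1..n} \<rightarrow>\<^sub>E {a, b}"
          and T: "T \<subseteq> {1..n}" "\<forall>i\<in>T. \<forall>j\<in>T. x i = x j" "i \<in> T" for a b x T i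
      proof -
        have "x \<in> profiles n" using x ab by (force simp: profiles_def PiE_iff)
        \<comment> \<open>Measurability with respect to \<open>M\<close> itself lets the integral be
          computed in the completion.\<close>
        then have "(\<lambda>f. dist (x i) (f x)) \<in> borel_measurable M"
          using evaluation by measurable
        then have "(\<integral>f. dist (x i) (f x) \<partial>completion M) = (\<integral>f. dist (x i) (f x) \<partial>M)"
          by (rule integral_completion)
        with strongly_proportional_random_rank[OF ab x T] show ?thesis by (simp only: eq)
      qed
      then show "strongly_proportional_in_expectation n M"
        unfolding strongly_proportional_in_expectation_def by blast
    qed
  qed
qed

end
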